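(* Let $L$ be a distributive lattice and $t\in L$, and consider the four-term chain complex with integer scalars $(a,b,c,d)$ satisfying $\gcd(a,b,c)=1$. Then for any $y\in L$ and every $n$, $$H_n(L,t)\cong H_n(\uparrow\! y,\ t\lor y)\oplus H_n(\downarrow\! y,\ t\land y).$$ In particular, if $L$ is finite, then $$H_n(L,t)\cong H_n(B_1,\bot)^{\oplus J},$$ where $J$ is the number of non-minimal join-irreducible elements in $L$ and $B_1=\{\bot,\top\}$ is the two-element Boolean algebra.
   Context: $\uparrow\! y=\{x\in L: x\ge y\}$ and $\downarrow\! y=\{x\in L:x\le y\}$ (sublattices of $L$). An element $x\in L$ is join-irreducible if $x=u\lor v$ implies $x=u$ or $x=v$; $J$ counts those different from the minimum of $L$. On a lattice $L$ consider four binary operations: $x\vdash y:=x$, $x\lor y$ (join), $x\land y$ (meet), $x\dashv y:=y$. The four-term chain complex $C(L)$ with integer scalars $(a,b,c,d)$ has $C_n(L)=\mathbb Z L^{n+1}$ for $n\ge 0$, $C_n(L)=0$ for $n<0$, and differential $\partial = a\,\partial^{\vdash}+b\,\partial^{\lor}+c\,\partial^{\land}+d\,\partial^{\dashv}$, where for a binary operation $\star$: $\partial^\star_n=\sum_{i=0}^n(-1)^i d_i^\star$ for $n\ge1$ (and $\partial_0=0$), with $d_0^\star(x_0,\dots,x_n)=(x_1,\dots,x_n)$ and $d_i^\star(x_0,\dots,x_n)=(x_0\star x_i,\dots,x_{i-1}\star x_i,x_{i+1},\dots,x_n)$ for $i\ge 1$. For $t\in L$, $C(\{t\})\subset C(L)$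 is the subcomplex spanned by the tuples $(t,\dots,t)$, $C(L,t):=C(L)/C(\{t\})$, and $H_n(L,t)$ is its homology. The same scalars $(a,b,c,d)$ are used for all lattices in the statement. *)

theory Defs
  imports "HOL-Algebra.Free_Abelian_Groups"
begin

text \<open>
  A lattice is the universe of a type of class \<open>distrib_lattice\<close>; its sublattices are subsets
  \<open>S\<close> of that type, carrying the restricted operations.
\<close>

definition join_irreducible :: "'a::lattice \<Rightarrow> bool"
  where "join_irreducible x \<longleftrightarrow> (\<forall>u v. x = sup u v \<longrightarrow> x = u \<or> x = v)"

definition is_minimum :: "'a::lattice \<Rightarrow> bool"
  where "is_minimum x \<longleftrightarrow> (\<forall>z. x \<le> z)"

text \<open>
  Degrees are integers. The tuple \<open>(x\<^sub>0, \<dots>, x\<^sub>n)\<close> is a list of length \<open>n + 1\<close>. The empty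
  list is excluded, so that there are no tuples (hence trivial chain groups) in degrees
  \<open>n < 0\<close>, including \<open>n = -1\<close>.
\<close>

definition tuples :: "'a set \<Rightarrow> int \<Rightarrow> 'a list set"
  where "tuples S n = {xs \<in> lists S. xs \<noteq> [] \<and> int (length xs) = n + 1}"

definition chains :: "'a set \<Rightarrow> int \<Rightarrow> ('a list \<Rightarrow>\<^sub>0 int) monoid"
  where "chains S n = free_Abelian_group (tuples S n)"

definition face :: "('a \<Rightarrow> 'a \<Rightarrow> 'a) \<Rightarrow> nat \<Rightarrow> 'a list \<Rightarrow> 'a list"
  where "face f i xs = map (\<lambda>u. f u (xs ! i)) (take i xs) @ drop (Suc i) xs"

definition op_boundary ::
    "('a \<Rightarrow> 'a \<Rightarrow> 'a) \<Rightarrow> int \<Rightarrow> ('a list \<Rightarrow>\<^sub>0 int) \<Rightarrow> ('a list \<Rightarrow>\<^sub>0 int)"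
  where "op_boundary f n =
    (if n \<ge> 1
     then frag_extend (\<lambda>xs. \<Sum>i\<le>nat n. frag_cmul ((- 1) ^ i) (frag_of (face f i xs)))
     else (\<lambda>_. 0))"

definition four_boundary ::
    "int \<Rightarrow> int \<Rightarrow> int \<Rightarrow> int \<Rightarrow> int \<Rightarrow> ('a::lattice list \<Rightarrow>\<^sub>0 int) \<Rightarrow> ('a list \<Rightarrow>\<^sub>0 int)"
  where "four_boundary a b c d n z =
    frag_cmul a (op_boundary (\<lambda>x y. x) n z) + frag_cmul b (op_boundary sup n z) +
    frag_cmul c (op_boundary inf n z) + frag_cmul d (op_boundary (\<lambda>x y. y) n z)"

definition rel_chains :: "'a set \<Rightarrow> 'a \<Rightarrow> int \<Rightarrow> ('a list \<Rightarrow>\<^sub>0 int) set monoid"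
  where "rel_chains S t n = chains S n Mod carrier (chains {t} n)"

text \<open>
  The map induced on cosets by a differential \<open>\<partial>\<close> that preserves the subcomplex \<open>K\<close>: for the
  coset \<open>X = K\<^sub>n + z\<close>, the sum of the sets \<open>K\<^sub>n\<^sub>-\<^sub>1\<close> and \<open>\<partial> X = \<partial> K\<^sub>n + \<partial> z\<close> is the coset
  \<open>K\<^sub>n\<^sub>-\<^sub>1 + \<partial> z\<close>.
\<close>

definition rel_boundary ::
    "int \<Rightarrow> int \<Rightarrow> int \<Rightarrow> int \<Rightarrow> 'a::lattice set \<Rightarrow> 'a \<Rightarrow> int \<Rightarrow>
     ('a list \<Rightarrow>\<^sub>0 int) set \<Rightarrow> ('a list \<Rightarrow>\<^sub>0 int) set"
  where "rel_boundary a b c d S t n X =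
    carrier (chains {t} (n - 1)) <#>\<^bsub>chains S (n - 1)\<^esub> (four_boundary a b c d n ` X)"

definition chain_homology ::
    "(int \<Rightarrow> 'c monoid) \<Rightarrow> (int \<Rightarrow> 'c \<Rightarrow> 'c) \<Rightarrow> int \<Rightarrow> 'c set monoid"
  where "chain_homology C \<delta> n =
    (C n)\<lparr>carrier := kernel (C n) (C (n - 1)) (\<delta> n)\<rparr> Mod (\<delta> (n + 1) ` carrier (C (n + 1)))"

definition rel_homology ::
    "int \<Rightarrow> int \<Rightarrow> int \<Rightarrow> int \<Rightarrow> 'a::lattice set \<Rightarrow> 'a \<Rightarrow> int \<Rightarrow>
     ('a list \<Rightarrow>\<^sub>0 int) set set monoid"
  where "rel_homology a b c d S t = chain_homology (rel_chains S t) (rel_boundary a b c d S t)"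

end

theory Submission
  imports Defs
begin

text \<open>
  For a fixed \<open>y\<close>, let \<open>P\<close> and \<open>Q\<close> be the maps that \<open>x \<mapsto> sup x y\<close> and \<open>x \<mapsto> inf x y\<close> induce on chains.
  In a distributive lattice these are lattice endomorphisms, hence chain maps. Appending \<open>y\<close> to a
  tuple, with the sign \<open>(-1)^length\<close>, is a chain homotopy between \<open>0\<close> and \<open>a + b P + c Q + d E\<close>, where
  \<open>E\<close> is induced by the constant \<open>y\<close> (\<open>full_boundary_cone\<close>); the same formula gives
  \<open>\<partial>\<partial> = 0\<close> by induction on the length of a tuple.

  The relative complex is a copy of the reduced complex, the kernel of the chain map to the
  one-element lattice, because \<open>C({t})\<close> is a complement of that kernel
  (\<open>red_homology_iso_rel_homology\<close>). Constants induce \<open>0\<close> on the reduced complex, so on reduced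
  homology \<open>a + b P + c Q = 0\<close> for every \<open>y\<close>. A cycle involves only finitely many lattice elements.
  With a \<open>y\<close> below all of them the relation says that \<open>a + b\<close> kills its class, and with a \<open>y\<close> above all
  of them that \<open>a + c\<close> does (\<open>annihilators_of_reduced_homology\<close>).

  Now \<open>R = 1 - P - Q\<close> satisfies \<open>P R = Q R = 0\<close> on reduced chains, so the relation for \<open>y\<close> gives
  \<open>a R = 0\<close> on homology, and then \<open>b R = c R = 0\<close>. As \<open>gcd(a, b, c) = 1\<close>, also \<open>R = 0\<close>: every class
  is the sum of its images under the retractions to the upper and to the lower set of \<open>y\<close>, which
  gives the splitting (\<open>red_homology_split\<close>).

  In a finite lattice, split the ideal below \<open>x\<close> along a lower cover \<open>y\<close> of \<open>x\<close>. The upper part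
  \<open>{y, x}\<close> is a copy of the two-element lattice, and exactly one join-irreducible element lies below \<open>x\<close>
  but not below \<open>y\<close> (\<open>unique_join_irreducible_outside_lower_cover\<close>), so the ideals below \<open>x\<close> give the
  formula by induction.
\<close>

section \<open>Chain maps and the cone homotopy\<close>

definition chain_map :: "('a \<Rightarrow> 'b) \<Rightarrow> ('a list \<Rightarrow>\<^sub>0 int) \<Rightarrow> ('b list \<Rightarrow>\<^sub>0 int)"
  where "chain_map f = frag_extend (\<lambda>xs. frag_of (map f xs))"

definition one_boundary :: "('a \<Rightarrow> 'a \<Rightarrow> 'a) \<Rightarrow> ('a list \<Rightarrow>\<^sub>0 int) \<Rightarrow> ('a list \<Rightarrow>\<^sub>0 int)"
  where "one_boundary f =
    frag_extend (\<lambda>xs. \<Sum>i<length xs. frag_cmul ((- 1) ^ i) (frag_of (face f i xs)))"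

text \<open>
  The differential without its truncation in degree \<open>0\<close>: a tuple \<open>(x)\<close> is sent to \<open>a + b + c + d\<close>
  times the empty tuple. The homotopy formula and \<open>\<partial>\<partial> = 0\<close> then hold without exceptions in low
  degrees, and no degree has to be carried along.
\<close>

definition full_boundary ::
    "int \<Rightarrow> int \<Rightarrow> int \<Rightarrow> int \<Rightarrow> ('a::lattice list \<Rightarrow>\<^sub>0 int) \<Rightarrow> ('a list \<Rightarrow>\<^sub>0 int)"
  where "full_boundary a b c d z =
    frag_cmul a (one_boundary (\<lambda>x y. x) z) + frag_cmul b (one_boundary sup z) +
    frag_cmul c (one_boundary inf z) + frag_cmul d (one_boundary (\<lambda>x y. y) z)"

text \<open>The sign is chosen so that the homotopy formula for the cone is free of signs.\<close>

definition cone :: "'a \<Rightarrow> ('a list \<Rightarrow>\<^sub>0 int) \<Rightarrow> ('a list \<Rightarrow>\<^sub>0 int)"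
  where "cone y = frag_extend (\<lambda>xs. frag_cmul ((- 1) ^ length xs) (frag_of (xs @ [y])))"

lemma additive_eqI_on_generators:
  assumes "\<And>z w. F (z - w) = F z - F w" "\<And>z w. G (z - w) = G z - G w"
    and "\<And>xs. xs \<in> Poly_Mapping.keys z \<Longrightarrow> F (frag_of xs) = G (frag_of xs)"
  shows "F z = (G z :: 'b \<Rightarrow>\<^sub>0 int)"
proof -
  have zero: "F 0 = 0" "G 0 = 0"
    using assms(1)[of 0 0] assms(2)[of 0 0] by auto
  show ?thesis
    by (rule frag_induction[OF order_refl, where P = "\<lambda>z. F z = G z"]) (auto simp: assms zero)
qed

lemma frag_cmul_diff: "frag_cmul k (z - w) = frag_cmul k z - frag_cmul k w"
  by (metis frag_cmul_distrib2 add_diff_cancel diff_add_cancel)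

lemma chain_map_diff: "chain_map f (z - w) = chain_map f z - chain_map f w"
  and chain_map_add: "chain_map f (z + w) = chain_map f z + chain_map f w"
  and chain_map_cmul: "chain_map f (frag_cmul k z) = frag_cmul k (chain_map f z)"
  and chain_map_0 [simp]: "chain_map f 0 = 0"
  and chain_map_of [simp]: "chain_map f (frag_of xs) = frag_of (map f xs)"
  by (simp_all add: chain_map_def frag_extend_diff frag_extend_add frag_extend_cmul)

lemma chain_map_sum: "chain_map f (\<Sum>i\<in>I. g i) = (\<Sum>i\<in>I. chain_map f (g i))"
  by (induction I rule: infinite_finite_induct) (simp_all add: chain_map_add)

lemma one_boundary_diff: "one_boundary f (z - w) = one_boundary f z - one_boundary f w"
  and one_boundary_of: "one_boundary f (frag_of xs) =
     (\<Sum>i<length xs. frag_cmul ((- 1) ^ i) (frag_of (face f i xs)))"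
  and one_boundary_0 [simp]: "one_boundary f 0 = 0"
  by (simp_all add: one_boundary_def frag_extend_diff)

lemma cone_diff: "cone y (z - w) = cone y z - cone y w"
  and cone_add: "cone y (z + w) = cone y z + cone y w"
  and cone_cmul: "cone y (frag_cmul k z) = frag_cmul k (cone y z)"
  and cone_of [simp]: "cone y (frag_of xs) = frag_cmul ((- 1) ^ length xs) (frag_of (xs @ [y]))"
  and cone_0 [simp]: "cone y 0 = 0"
  by (simp_all add: cone_def frag_extend_diff frag_extend_add frag_extend_cmul)

lemma cone_sum: "cone y (\<Sum>i\<in>I. g i) = (\<Sum>i\<in>I. cone y (g i))"
  by (induction I rule: infinite_finite_induct) (simp_all add: cone_add)

lemma full_boundary_diff:
  "full_boundary a b c d (z - w) = full_boundary a b c d z - full_boundary a b c d w"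
  by (simp add: full_boundary_def one_boundary_diff frag_cmul_diff)

lemma full_boundary_0 [simp]: "full_boundary a b c d 0 = 0"
  by (simp add: full_boundary_def)

lemma full_boundary_minus: "full_boundary a b c d (- z) = - full_boundary a b c d z"
  using full_boundary_diff[of a b c d 0 z] by simp

lemma full_boundary_add:
  "full_boundary a b c d (z + w) = full_boundary a b c d z + full_boundary a b c d w"
  using full_boundary_diff[of a b c d z "- w"] by (simp add: full_boundary_minus)

lemma full_boundary_cmul:
  "full_boundary a b c d (frag_cmul k z) = frag_cmul k (full_boundary a b c d z)"
  by (simp add: full_boundary_def one_boundary_def frag_extend_cmul frag_cmul_distrib2 mult.commute)

lemma chain_map_comp: "chain_map f (chain_map g z) = chain_map (\<lambda>x. f (g x)) z"
  by (rule additive_eqI_on_generators[where z = z]) (simp_all add: chain_map_diff comp_def)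

lemma chain_map_cong:
  assumes "\<And>xs u. xs \<in> Poly_Mapping.keys z \<Longrightarrow> u \<in> set xs \<Longrightarrow> f u = g u"
  shows "chain_map f z = chain_map g z"
proof (rule additive_eqI_on_generators[where z = z])
  fix xs assume "xs \<in> Poly_Mapping.keys z"
  then have "map f xs = map g xs"
    using assms by simp
  then show "chain_map f (frag_of xs) = chain_map g (frag_of xs)"
    by (simp only: chain_map_of)
qed (simp_all add: chain_map_diff)

lemma chain_map_ident: "chain_map (\<lambda>x. x) z = z"
  by (simp add: chain_map_def flip: frag_expansion)

lemma chain_map_id_on:
  assumes "\<And>xs u. xs \<in> Poly_Mapping.keys z \<Longrightarrow> u \<in> set xs \<Longrightarrow> f u = u"
  shows "chain_map f z = z"
  using chain_map_cong[of z f "\<lambda>x. x"] assms by (simp add: chain_map_ident)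

lemma chain_map_one_boundary:
  assumes "\<And>u v. g (f u v) = f' (g u) (g v)"
  shows "chain_map g (one_boundary f z) = one_boundary f' (chain_map g z)"
proof (rule additive_eqI_on_generators[where z = z])
  fix xs
  have "map g (face f i xs) = face f' i (map g xs)" if "i < length xs" for i
    using that by (simp add: face_def assms take_map drop_map comp_def)
  then show "chain_map g (one_boundary f (frag_of xs)) = one_boundary f' (chain_map g (frag_of xs))"
    by (simp add: one_boundary_of chain_map_sum chain_map_cmul)
qed (simp_all add: one_boundary_diff chain_map_diff)

lemma chain_map_full_boundary:
  fixes g :: "'a::lattice \<Rightarrow> 'b::lattice"
  assumes "\<And>u v. g (sup u v) = sup (g u) (g v)" "\<And>u v. g (inf u v) = inf (g u) (g v)"
  shows "chain_map g (full_boundary a b c d z) = full_boundary a b c d (chain_map g z)"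
  using chain_map_one_boundary[of g "\<lambda>x y. x" "\<lambda>x y. x"] chain_map_one_boundary[of g sup sup]
    chain_map_one_boundary[of g inf inf] chain_map_one_boundary[of g "\<lambda>x y. y" "\<lambda>x y. y"] assms
  by (simp add: full_boundary_def chain_map_add chain_map_cmul)

lemma full_boundary_sup:
  fixes y :: "'a::distrib_lattice"
  shows "chain_map (\<lambda>u. sup u y) (full_boundary a b c d z) =
    full_boundary a b c d (chain_map (\<lambda>u. sup u y) z)"
  by (rule chain_map_full_boundary) (simp add: ac_simps, simp add: sup_inf_distrib2)

lemma full_boundary_inf:
  fixes y :: "'a::distrib_lattice"
  shows "chain_map (\<lambda>u. inf u y) (full_boundary a b c d z) =
    full_boundary a b c d (chain_map (\<lambda>u. inf u y) z)"
  by (rule chain_map_full_boundary) (simp add: inf_sup_distrib2, simp add: ac_simps)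

lemma full_boundary_const:
  fixes y :: "'b::lattice"
  shows "chain_map (\<lambda>u. y) (full_boundary a b c d z) = full_boundary a b c d (chain_map (\<lambda>u. y) z)"
  by (rule chain_map_full_boundary) simp_all

text \<open>
  The faces of \<open>(x\<^sub>0, \<dots>, x\<^sub>n, y)\<close> that delete some \<open>x\<^sub>i\<close> are the cones over the faces of
  \<open>(x\<^sub>0, \<dots>, x\<^sub>n)\<close>, with the opposite sign, and cancel. The face that deletes \<open>y\<close> remains.
\<close>

lemma one_boundary_cone:
  "one_boundary f (cone y z) + cone y (one_boundary f z) = chain_map (\<lambda>u. f u y) z"
proof (rule additive_eqI_on_generators[where z = z])
  fix xs :: "'a list"
  define n where "n = length xs"
  have face_append: "face f i (xs @ [y]) = face f i xs @ [y]"
    and len: "length (face f i xs) = n - 1" if "i < n" for i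
    using that by (simp_all add: face_def nth_append n_def)
  have face_last: "face f n (xs @ [y]) = map (\<lambda>u. f u y) xs"
    by (simp add: face_def n_def)
  have "one_boundary f (cone y (frag_of xs)) =
      frag_cmul ((- 1) ^ n) (\<Sum>i<Suc n. frag_cmul ((- 1) ^ i) (frag_of (face f i (xs @ [y]))))"
    by (simp add: one_boundary_def frag_extend_cmul n_def)
  also have "\<dots> = (\<Sum>i<n. frag_cmul ((- 1) ^ n * (- 1) ^ i) (frag_of (face f i xs @ [y])))
      + frag_of (map (\<lambda>u. f u y) xs)"
    by (simp add: frag_cmul_distrib2 frag_cmul_sum face_append face_last)
  finally have 1: "one_boundary f (cone y (frag_of xs)) = \<dots>" .
  have "cone y (one_boundary f (frag_of xs)) =
      (\<Sum>i<n. frag_cmul ((- 1) ^ i * (- 1) ^ (n - 1)) (frag_of (face f i xs @ [y])))"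
    by (simp add: one_boundary_of cone_sum cone_cmul len n_def)
  also have "\<dots> = (\<Sum>i<n. - frag_cmul ((- 1) ^ n * (- 1) ^ i) (frag_of (face f i xs @ [y])))"
  proof (rule sum.cong)
    fix i assume "i \<in> {..<n}"
    then obtain m where "n = Suc m" by (cases n) auto
    then show "frag_cmul ((- 1) ^ i * (- 1) ^ (n - 1)) (frag_of (face f i xs @ [y])) =
        - frag_cmul ((- 1) ^ n * (- 1) ^ i) (frag_of (face f i xs @ [y]))"
      by (simp add: mult.commute)
  qed simp
  finally have 2: "cone y (one_boundary f (frag_of xs)) = \<dots>" .
  show "one_boundary f (cone y (frag_of xs)) + cone y (one_boundary f (frag_of xs)) =
      chain_map (\<lambda>u. f u y) (frag_of xs)"
    by (simp add: 1 2 sum_negf del: cone_of minus_frag_cmul)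
qed (simp_all add: one_boundary_diff cone_diff chain_map_diff)

lemma full_boundary_cone:
  fixes y :: "'a::lattice"
  shows "full_boundary a b c d (cone y z) + cone y (full_boundary a b c d z) =
    frag_cmul a z + frag_cmul b (chain_map (\<lambda>u. sup u y) z) +
    frag_cmul c (chain_map (\<lambda>u. inf u y) z) + frag_cmul d (chain_map (\<lambda>u. y) z)"
proof -
  have *: "one_boundary f (cone y z) = chain_map (\<lambda>u. f u y) z - cone y (one_boundary f z)"
    for f :: "'a \<Rightarrow> 'a \<Rightarrow> 'a"
    using one_boundary_cone[of f y z] by (simp add: eq_diff_eq)
  show ?thesis
    by (simp add: full_boundary_def * cone_add cone_cmul frag_cmul_diff chain_map_ident)
qed

text \<open>
  The homotopy formula shows that \<open>\<partial>\<partial>\<close> commutes with cones. Every tuple is, up to sign, an iterated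
  cone over the empty tuple, where \<open>\<partial>\<close> vanishes.
\<close>

lemma full_boundary_full_boundary:
  fixes z :: "'a::distrib_lattice list \<Rightarrow>\<^sub>0 int"
  shows "full_boundary a b c d (full_boundary a b c d z) = 0"
proof -
  let ?D = "full_boundary a b c d :: ('a list \<Rightarrow>\<^sub>0 int) \<Rightarrow> _"
  define \<Phi> :: "'a \<Rightarrow> ('a list \<Rightarrow>\<^sub>0 int) \<Rightarrow> 'a list \<Rightarrow>\<^sub>0 int" where "\<Phi> y z =
    frag_cmul a z + frag_cmul b (chain_map (\<lambda>u. sup u y) z) +
    frag_cmul c (chain_map (\<lambda>u. inf u y) z) + frag_cmul d (chain_map (\<lambda>u. y) z)" for y z
  have cone: "?D (cone y z) = \<Phi> y z - cone y (?D z)" for y z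
    using full_boundary_cone[of a b c d y z] by (simp add: \<Phi>_def eq_diff_eq)
  have comm: "?D (\<Phi> y z) = \<Phi> y (?D z)" for y z
    by (simp add: \<Phi>_def full_boundary_add full_boundary_cmul full_boundary_sup full_boundary_inf
        full_boundary_const)
  have step: "?D (?D (cone y z)) = cone y (?D (?D z))" for y z
    by (simp add: cone full_boundary_diff comm)
  have base: "?D (?D (frag_of xs)) = 0" for xs
  proof (induction xs rule: rev_induct)
    case Nil
    show ?case by (simp add: full_boundary_def one_boundary_of)
  next
    case (snoc y xs)
    have "frag_of (xs @ [y]) = cone y (frag_cmul ((- 1) ^ length xs) (frag_of xs))"
      by (simp add: cone_cmul)
    then show ?case
      by (simp only: step full_boundary_cmul snoc.IH frag_cmul_zero2 cone_0)
  qed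
  show ?thesis
    by (rule additive_eqI_on_generators[where z = z]) (simp_all add: full_boundary_diff base)
qed

section \<open>Subquotients of additive groups\<close>

text \<open>
  All groups of chains, cycles and boundaries are sets closed under subtraction in one additive
  group, so that their elements can be compared and added across different sublattices.
\<close>

definition add_group :: "'g::ab_group_add set \<Rightarrow> 'g monoid"
  where "add_group Z = \<lparr>carrier = Z, monoid.mult = (+), one = 0\<rparr>"

definition add_subgroup :: "'g::ab_group_add set \<Rightarrow> bool"
  where "add_subgroup Z \<longleftrightarrow> 0 \<in> Z \<and> (\<forall>x\<in>Z. \<forall>y\<in>Z. x - y \<in> Z)"

lemma add_group_simps [simp]:
  "carrier (add_group Z) = Z" "x \<otimes>\<^bsub>add_group Z\<^esub> y = x + y" "\<one>\<^bsub>add_group Z\<^esub> = 0"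
  by (simp_all add: add_group_def)

lemma add_subgroup_0: "add_subgroup Z \<Longrightarrow> 0 \<in> Z"
  and add_subgroup_diff: "add_subgroup Z \<Longrightarrow> x \<in> Z \<Longrightarrow> y \<in> Z \<Longrightarrow> x - y \<in> Z"
  by (simp_all add: add_subgroup_def)

lemma add_subgroup_uminus: "add_subgroup Z \<Longrightarrow> x \<in> Z \<Longrightarrow> - x \<in> Z"
  by (metis add_subgroup_0 add_subgroup_diff diff_0)

lemma add_subgroup_add: "add_subgroup Z \<Longrightarrow> x \<in> Z \<Longrightarrow> y \<in> Z \<Longrightarrow> x + y \<in> Z"
  by (metis add_subgroup_diff add_subgroup_uminus diff_minus_eq_add)

lemma comm_group_add_group:
  assumes "add_subgroup Z" shows "comm_group (add_group Z)"
proof (rule comm_groupI)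
  fix x assume "x \<in> carrier (add_group Z)"
  then show "\<exists>y\<in>carrier (add_group Z). y \<otimes>\<^bsub>add_group Z\<^esub> x = \<one>\<^bsub>add_group Z\<^esub>"
    using add_subgroup_uminus[OF assms] by (intro bexI[of _ "- x"]) auto
qed (use add_subgroup_0[OF assms] add_subgroup_add[OF assms] in \<open>auto simp: add.assoc add.commute\<close>)

lemma group_add_group: "add_subgroup Z \<Longrightarrow> group (add_group Z)"
  using comm_group_add_group by (rule comm_group.axioms(2))

lemma normal_add_group:
  assumes Z: "add_subgroup Z" and B: "add_subgroup B" and "B \<subseteq> Z"
  shows "B \<lhd> add_group Z"
proof -
  interpret comm_group "add_group Z"
    using Z by (rule comm_group_add_group)
  have "inv\<^bsub>add_group Z\<^esub> x = - x" if "x \<in> Z" for x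
    using that add_subgroup_uminus[OF Z that] by (intro inv_equality) auto
  then have "subgroup B (add_group Z)"
    using assms add_subgroup_0[OF B] add_subgroup_add[OF B] add_subgroup_uminus[OF B]
    by (intro subgroupI) auto
  then show ?thesis
    by (simp add: normal_iff_subgroup)
qed

lemma r_coset_add_group: "B #>\<^bsub>add_group Z\<^esub> z = {k + z | k. k \<in> B}"
  by (auto simp: r_coset_def)

lemma r_coset_add_group_eq_iff:
  assumes "add_subgroup B"
  shows "B #>\<^bsub>add_group Z\<^esub> z = B #>\<^bsub>add_group Z\<^esub> w \<longleftrightarrow> z - w \<in> B"
proof
  assume "B #>\<^bsub>add_group Z\<^esub> z = B #>\<^bsub>add_group Z\<^esub> w"
  then have "z \<in> {k + w | k. k \<in> B}"
    using add_subgroup_0[OF assms] by (auto simp: r_coset_add_group)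
  then show "z - w \<in> B"
    by auto
next
  assume "z - w \<in> B"
  then have "k + (z - w) \<in> B" "k - (z - w) \<in> B" if "k \<in> B" for k
    using that assms by (auto intro: add_subgroup_add add_subgroup_diff)
  then show "B #>\<^bsub>add_group Z\<^esub> z = B #>\<^bsub>add_group Z\<^esub> w"
    by (auto simp: r_coset_add_group) (metis add.assoc add_diff_cancel diff_add_cancel)+
qed

lemma r_coset_add_group_eq_self_iff:
  assumes "add_subgroup B"
  shows "B #>\<^bsub>add_group Z\<^esub> z = B \<longleftrightarrow> z \<in> B"
  using r_coset_add_group_eq_iff[OF assms, of Z z 0] by (simp add: r_coset_add_group)

lemma first_isomorphism_add_group:
  assumes "add_subgroup Z" "group H" "h \<in> hom (add_group Z) H"
    and "\<And>y. y \<in> carrier H \<Longrightarrow> \<exists>z\<in>Z. h z = y"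
    and "\<And>z. z \<in> Z \<Longrightarrow> h z = \<one>\<^bsub>H\<^esub> \<longleftrightarrow> z \<in> B" and "B \<subseteq> Z"
  shows "add_group Z Mod B \<cong> H"
proof -
  interpret group_hom "add_group Z" H h
    using assms by (simp add: group_hom_def group_hom_axioms_def group_add_group)
  have "kernel (add_group Z) H h = B"
    using assms(5,6) by (auto simp: kernel_def)
  moreover have "h ` carrier (add_group Z) = carrier H"
    using assms(3,4) by (auto simp: hom_def) force
  ultimately show ?thesis
    using FactGroup_iso by simp
qed

section \<open>The reduced complex\<close>

definition sublattice :: "'a::lattice set \<Rightarrow> bool"
  where "sublattice S \<longleftrightarrow> (\<forall>x\<in>S. \<forall>y\<in>S. sup x y \<in> S \<and> inf x y \<in> S)"

text \<open>
  The kernel of the chain map to the one-element lattice \<open>unit\<close>, that is, the chains whose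
  coefficients have sum \<open>0\<close>. As a kernel of an induced map it is preserved by everything natural.
\<close>

definition red_chains :: "'a set \<Rightarrow> int \<Rightarrow> ('a list \<Rightarrow>\<^sub>0 int) set"
  where "red_chains S n =
    {z. Poly_Mapping.keys z \<subseteq> tuples S n \<and> chain_map (\<lambda>_. ()) z = 0}"

definition red_cycles ::
    "int \<Rightarrow> int \<Rightarrow> int \<Rightarrow> int \<Rightarrow> 'a::lattice set \<Rightarrow> int \<Rightarrow> ('a list \<Rightarrow>\<^sub>0 int) set"
  where "red_cycles a b c d S n = {z \<in> red_chains S n. full_boundary a b c d z = 0}"

definition red_boundaries ::
    "int \<Rightarrow> int \<Rightarrow> int \<Rightarrow> int \<Rightarrow> 'a::lattice set \<Rightarrow> int \<Rightarrow> ('a list \<Rightarrow>\<^sub>0 int) set"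
  where "red_boundaries a b c d S n = full_boundary a b c d ` red_chains S (n + 1)"

definition red_homology ::
    "int \<Rightarrow> int \<Rightarrow> int \<Rightarrow> int \<Rightarrow> 'a::lattice set \<Rightarrow> int \<Rightarrow> ('a list \<Rightarrow>\<^sub>0 int) set monoid"
  where "red_homology a b c d S n =
    add_group (red_cycles a b c d S n) Mod red_boundaries a b c d S n"

lemma keys_chain_map:
  assumes "Poly_Mapping.keys z \<subseteq> tuples S n" "f ` S \<subseteq> T"
  shows "Poly_Mapping.keys (chain_map f z) \<subseteq> tuples T n"
proof -
  have "Poly_Mapping.keys (chain_map f z) \<subseteq> map f ` Poly_Mapping.keys z"
    unfolding chain_map_def using keys_frag_extend by fastforce
  also have "\<dots> \<subseteq> map f ` tuples S n"
    using assms(1) by (rule image_mono)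
  also have "\<dots> \<subseteq> tuples T n"
    using assms(2) by (fastforce simp: tuples_def)
  finally show ?thesis .
qed

lemma keys_cone:
  assumes "Poly_Mapping.keys z \<subseteq> tuples S n" "y \<in> S"
  shows "Poly_Mapping.keys (cone y z) \<subseteq> tuples S (n + 1)"
proof -
  have "Poly_Mapping.keys (cone y z) \<subseteq> (\<lambda>xs. xs @ [y]) ` Poly_Mapping.keys z"
    unfolding cone_def using keys_frag_extend by (fastforce simp: keys_cmul)
  also have "\<dots> \<subseteq> (\<lambda>xs. xs @ [y]) ` tuples S n"
    using assms(1) by (rule image_mono)
  also have "\<dots> \<subseteq> tuples S (n + 1)"
    using assms(2) by (auto simp: tuples_def)
  finally show ?thesis .
qed

text \<open>A constant map factors through the one-element lattice.\<close>

lemma chain_map_const_reduced: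
  assumes "z \<in> red_chains S n" shows "chain_map (\<lambda>_. y) z = 0"
  using assms chain_map_comp[of "\<lambda>_. y" "\<lambda>_. ()" z] by (simp add: red_chains_def)

lemma red_chains_zero: "0 \<in> red_chains S n"
  by (simp add: red_chains_def)

lemma red_chains_diff:
  "z \<in> red_chains S n \<Longrightarrow> w \<in> red_chains S n \<Longrightarrow> z - w \<in> red_chains S n"
  using keys_diff[of z w] by (auto simp: red_chains_def chain_map_diff)

lemma red_chains_mono: "S \<subseteq> T \<Longrightarrow> red_chains S n \<subseteq> red_chains T n"
  by (auto simp: red_chains_def tuples_def)

lemma red_chains_chain_map:
  "z \<in> red_chains S n \<Longrightarrow> f ` S \<subseteq> T \<Longrightarrow> chain_map f z \<in> red_chains T n"
  by (auto simp: red_chains_def chain_map_comp keys_chain_map[THEN subsetD])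

lemma red_chains_cone:
  assumes "z \<in> red_chains S n" "y \<in> S" shows "cone y z \<in> red_chains S (n + 1)"
proof -
  have "chain_map (\<lambda>_. ()) (cone y z) = cone () (chain_map (\<lambda>_. ()) z)"
    by (rule additive_eqI_on_generators[where z = z]) (simp_all add: chain_map_diff cone_diff chain_map_cmul)
  then show ?thesis
    using assms keys_cone[of z S n y] by (auto simp: red_chains_def)
qed

section \<open>Comparison with the truncated differential\<close>

lemma op_boundary_eq_one_boundary:
  assumes "Poly_Mapping.keys z \<subseteq> tuples S n" "n \<ge> 1"
  shows "op_boundary f n z = one_boundary f z"
proof -
  have "{..nat n} = {..<length xs}" if "xs \<in> Poly_Mapping.keys z" for xs
  proof -
    have "length xs = Suc (nat n)"
      using that assms by (auto simp: tuples_def)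
    then show ?thesis
      by (simp add: lessThan_Suc_atMost)
  qed
  then show ?thesis
    using assms(2) by (auto simp: op_boundary_def one_boundary_def intro!: frag_extend_eq)
qed

lemma four_boundary_eq_full_boundary:
  assumes "Poly_Mapping.keys z \<subseteq> tuples S n" "n \<ge> 1"
  shows "four_boundary a b c d n z = full_boundary a b c d z"
  by (simp add: four_boundary_def full_boundary_def op_boundary_eq_one_boundary[OF assms])

lemma four_boundary_low: "n < 1 \<Longrightarrow> four_boundary a b c d n z = 0"
  by (simp add: four_boundary_def op_boundary_def)

lemma four_boundary_diff:
  "four_boundary a b c d n (z - w) = four_boundary a b c d n z - four_boundary a b c d n w"
  by (simp add: four_boundary_def op_boundary_def frag_extend_diff frag_cmul_diff)

lemma keys_op_boundary:
  assumes "Poly_Mapping.keys z \<subseteq> tuples S n" "\<And>x y. x \<in> S \<Longrightarrow> y \<in> S \<Longrightarrow> f x y \<in> S"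
  shows "Poly_Mapping.keys (op_boundary f n z) \<subseteq> tuples S (n - 1)"
proof (cases "n \<ge> 1")
  case True
  have face: "face f i xs \<in> tuples S (n - 1)" if "xs \<in> tuples S n" "i \<le> nat n" for i xs
  proof -
    have len: "length xs = Suc (nat n)" and xs: "set xs \<subseteq> S"
      using that True by (auto simp: tuples_def)
    then have "xs ! i \<in> S"
      using that(2) by (metis le_imp_less_Suc nth_mem subsetD)
    then have "set (face f i xs) \<subseteq> S"
      using xs assms(2) set_take_subset[of i xs] set_drop_subset[of "Suc i" xs]
      by (fastforce simp: face_def)
    moreover have "length (face f i xs) = nat n"
      using len that(2) by (simp add: face_def)
    ultimately show ?thesis
      using True by (auto simp: tuples_def)
  qed
  have "Poly_Mapping.keys (\<Sum>i\<le>nat n. frag_cmul ((- 1) ^ i) (frag_of (face f i xs)))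
      \<subseteq> tuples S (n - 1)" if "xs \<in> Poly_Mapping.keys z" for xs
  proof -
    have "(\<Sum>i\<le>nat n. frag_cmul ((- 1) ^ i) (frag_of (face f i xs)))
        \<in> carrier (free_Abelian_group (tuples S (n - 1)))"
      using that assms(1) face by (intro sum_closed_free_Abelian_group) auto
    then show ?thesis by simp
  qed
  then show ?thesis
    using True by (auto simp: op_boundary_def dest!: keys_frag_extend[THEN subsetD])
next
  case False
  then show ?thesis by (simp add: op_boundary_def)
qed

lemma keys_four_boundary:
  assumes "Poly_Mapping.keys z \<subseteq> tuples S n" "sublattice S"
  shows "Poly_Mapping.keys (four_boundary a b c d n z) \<subseteq> tuples S (n - 1)"
proof -
  have cmul: "frag_cmul k w \<in> carrier (free_Abelian_group T)"
    if "Poly_Mapping.keys w \<subseteq> T" for k w and T :: "'a list set"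
    using that keys_cmul[of k w] by auto
  have add: "v + w \<in> carrier (free_Abelian_group T)"
    if "v \<in> carrier (free_Abelian_group T)" "w \<in> carrier (free_Abelian_group T)"
    for v w and T :: "'a list set"
    using that keys_add[of v w] by auto
  have "four_boundary a b c d n z \<in> carrier (free_Abelian_group (tuples S (n - 1)))"
    unfolding four_boundary_def using assms
    by (intro add cmul keys_op_boundary) (auto simp: sublattice_def)
  then show ?thesis by simp
qed

text \<open>
  The truncation is invisible on reduced chains: in degree \<open>0\<close> the untruncated differential is a
  multiple of the sum of the coefficients.
\<close>

lemma four_boundary_reduced:
  assumes "z \<in> red_chains S n"
  shows "four_boundary a b c d n z = full_boundary a b c d z"
proof -
  have keys: "Poly_Mapping.keys z \<subseteq> tuples S n" and red: "chain_map (\<lambda>_. ()) z = 0"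
    using assms by (auto simp: red_chains_def)
  consider "n \<ge> 1" | "n = 0" | "n < 0" by linarith
  then show ?thesis
  proof cases
    case 1
    then show ?thesis using keys four_boundary_eq_full_boundary by blast
  next
    case 2
    \<comment> \<open>Every face of a tuple of length 1 is empty, so only the sum of the coefficients matters.\<close>
    have "one_boundary f z = frag_extend (\<lambda>_. frag_of []) (chain_map (\<lambda>_. ()) z)"
      for f :: "'a \<Rightarrow> 'a \<Rightarrow> 'a"
    proof (rule additive_eqI_on_generators[where z = z])
      fix xs assume "xs \<in> Poly_Mapping.keys z"
      then have "length xs = 1"
        using keys 2 by (auto simp: tuples_def)
      then show "one_boundary f (frag_of xs) =
          frag_extend (\<lambda>_. frag_of []) (chain_map (\<lambda>_. ()) (frag_of xs))"
        by (simp add: one_boundary_of face_def)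
    qed (simp_all add: one_boundary_diff chain_map_diff frag_extend_diff)
    then have "one_boundary f z = 0" for f :: "'a \<Rightarrow> 'a \<Rightarrow> 'a"
      by (simp add: red)
    then show ?thesis using 2 by (simp add: four_boundary_low full_boundary_def)
  next
    case 3
    then have "xs \<notin> tuples S n" for xs
      by (cases xs) (auto simp: tuples_def)
    then have "tuples S n = {}" by blast
    then have "z = 0" using keys by simp
    then show ?thesis using 3 by (simp add: four_boundary_low)
  qed
qed

lemma four_boundary_four_boundary:
  fixes z :: "'a::distrib_lattice list \<Rightarrow>\<^sub>0 int"
  assumes "Poly_Mapping.keys z \<subseteq> tuples UNIV (n + 1)"
  shows "four_boundary a b c d n (four_boundary a b c d (n + 1) z) = 0"
proof (cases "n \<ge> 1")
  case True
  have "Poly_Mapping.keys (four_boundary a b c d (n + 1) z) \<subseteq> tuples UNIV n"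
    using keys_four_boundary[OF assms, of a b c d] by (simp add: sublattice_def)
  with True show ?thesis
    by (simp add: four_boundary_eq_full_boundary[OF assms]
        four_boundary_eq_full_boundary[of _ UNIV n] full_boundary_full_boundary)
qed (simp add: four_boundary_low)

lemma full_boundary_red_chains:
  assumes "z \<in> red_chains S n" "sublattice S"
  shows "full_boundary a b c d z \<in> red_chains S (n - 1)"
proof -
  have keys: "Poly_Mapping.keys z \<subseteq> tuples S n" and red: "chain_map (\<lambda>_. ()) z = 0"
    using assms by (auto simp: red_chains_def)
  have "chain_map (\<lambda>_. ()) (full_boundary a b c d z) = 0"
    by (simp add: full_boundary_const red)
  then show ?thesis
    using keys_four_boundary[OF keys assms(2), of a b c d] four_boundary_reduced[OF assms(1)]
    by (simp add: red_chains_def)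
qed

lemma add_subgroup_red_cycles: "add_subgroup (red_cycles a b c d S n)"
  by (simp add: add_subgroup_def red_cycles_def red_chains_zero red_chains_diff full_boundary_diff)

lemma add_subgroup_red_boundaries: "add_subgroup (red_boundaries a b c d S n)"
  unfolding add_subgroup_def
proof (intro conjI ballI)
  show "0 \<in> red_boundaries a b c d S n"
    unfolding red_boundaries_def by (intro image_eqI[of _ _ 0]) (simp_all add: red_chains_zero)
next
  fix x y assume "x \<in> red_boundaries a b c d S n" "y \<in> red_boundaries a b c d S n"
  then obtain v w where "v \<in> red_chains S (n + 1)" "w \<in> red_chains S (n + 1)"
    and "x = full_boundary a b c d v" "y = full_boundary a b c d w"
    by (auto simp: red_boundaries_def)
  then show "x - y \<in> red_boundaries a b c d S n"
    unfolding red_boundaries_def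
    by (intro image_eqI[of _ _ "v - w"]) (simp_all add: red_chains_diff full_boundary_diff)
qed

lemma red_boundaries_subset:
  fixes S :: "'a::distrib_lattice set"
  assumes "sublattice S"
  shows "red_boundaries a b c d S n \<subseteq> red_cycles a b c d S n"
  using full_boundary_red_chains[OF _ assms, of _ "n + 1" a b c d]
  by (auto simp: red_boundaries_def red_cycles_def full_boundary_full_boundary)

lemma group_red_homology:
  fixes S :: "'a::distrib_lattice set"
  assumes "sublattice S"
  shows "group (red_homology a b c d S n)"
  unfolding red_homology_def
  by (intro normal.factorgroup_is_group normal_add_group add_subgroup_red_cycles
      add_subgroup_red_boundaries red_boundaries_subset assms)

section \<open>Relative homology is reduced homology\<close>

lemma chains_eq: "chains S n = add_group {z. Poly_Mapping.keys z \<subseteq> tuples S n}"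
  by (simp add: chains_def free_Abelian_group_def add_group_def)

lemma add_subgroup_keys: "add_subgroup {z :: 'b \<Rightarrow>\<^sub>0 int. Poly_Mapping.keys z \<subseteq> T}"
  using keys_diff by (fastforce simp: add_subgroup_def)

definition rel_class :: "'a set \<Rightarrow> 'a \<Rightarrow> int \<Rightarrow> ('a list \<Rightarrow>\<^sub>0 int) \<Rightarrow> ('a list \<Rightarrow>\<^sub>0 int) set"
  where "rel_class S t n z = carrier (chains {t} n) #>\<^bsub>chains S n\<^esub> z"

lemma normal_point_chains:
  assumes "t \<in> S" shows "carrier (chains {t} n) \<lhd> chains S n"
  unfolding chains_eq add_group_simps using assms
  by (intro normal_add_group add_subgroup_keys) (auto simp: tuples_def)

lemma comm_group_rel_chains:
  assumes "t \<in> S" shows "comm_group (rel_chains S t n)"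
proof -
  interpret comm_group "chains S n"
    unfolding chains_eq by (rule comm_group_add_group[OF add_subgroup_keys])
  show ?thesis
    unfolding rel_chains_def using normal_point_chains[OF assms]
    by (intro abelian_FactGroup normal_imp_subgroup)
qed

lemma rel_class_hom:
  assumes "t \<in> S" shows "rel_class S t n \<in> hom (chains S n) (rel_chains S t n)"
  using normal.r_coset_hom_Mod[OF normal_point_chains[OF assms]]
  unfolding rel_class_def[abs_def] rel_chains_def .

lemma carrier_rel_chains:
  "carrier (rel_chains S t n) = rel_class S t n ` {z. Poly_Mapping.keys z \<subseteq> tuples S n}"
  by (simp add: rel_chains_def carrier_FactGroup rel_class_def chains_eq)

lemma one_rel_chains: "\<one>\<^bsub>rel_chains S t n\<^esub> = rel_class S t n 0"
  by (simp add: rel_chains_def rel_class_def chains_eq r_coset_add_group)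

lemma rel_class_eq_iff:
  "rel_class S t n z = rel_class S t n w \<longleftrightarrow> Poly_Mapping.keys (z - w) \<subseteq> tuples {t} n"
  unfolding rel_class_def chains_eq add_group_simps
  by (subst r_coset_add_group_eq_iff[OF add_subgroup_keys]) simp

text \<open>The differential preserves \<open>C({t})\<close>, so on cosets it is given by any representative.\<close>

lemma rel_boundary_class:
  fixes S :: "'a::lattice set"
  shows "rel_boundary a b c d S t n (rel_class S t n z) =
    rel_class S t (n - 1) (four_boundary a b c d n z)"
proof -
  let ?D = "four_boundary a b c d n :: ('a list \<Rightarrow>\<^sub>0 int) \<Rightarrow> _"
  let ?K = "\<lambda>n. {z. Poly_Mapping.keys z \<subseteq> tuples {t} n}"
  have add: "?D (k + z) = ?D k + ?D z" for k
    using four_boundary_diff[of a b c d n "k + z" z] by (simp add: eq_diff_eq)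
  have D: "?D k \<in> ?K (n - 1)" if "k \<in> ?K n" for k
    using that keys_four_boundary[of k "{t}" n a b c d] by (simp add: sublattice_def)
  have "?D ` rel_class S t n z = (\<lambda>k. ?D k + ?D z) ` ?K n"
    by (simp add: rel_class_def chains_eq r_coset_add_group setcompr_eq_image image_image add)
  then have "rel_boundary a b c d S t n (rel_class S t n z) =
      {l + (?D k + ?D z) | k l. k \<in> ?K n \<and> l \<in> ?K (n - 1)}"
    unfolding rel_boundary_def chains_eq add_group_simps set_mult_def by auto
  also have "\<dots> = {l + ?D z | l. l \<in> ?K (n - 1)}"
  proof (intro equalityI subsetI)
    fix x assume "x \<in> {l + (?D k + ?D z) | k l. k \<in> ?K n \<and> l \<in> ?K (n - 1)}"
    then obtain k l where "x = (l + ?D k) + ?D z" "k \<in> ?K n" "l \<in> ?K (n - 1)"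
      by (auto simp: add.assoc)
    then show "x \<in> {l + ?D z | l. l \<in> ?K (n - 1)}"
      using add_subgroup_add[OF add_subgroup_keys] D by blast
  next
    fix x assume "x \<in> {l + ?D z | l. l \<in> ?K (n - 1)}"
    then obtain l where l: "x = l + ?D z" "l \<in> ?K (n - 1)"
      by blast
    have "?D 0 = 0"
      using four_boundary_diff[of a b c d n 0 0] by simp
    with l have "x = l + (?D 0 + ?D z)"
      by simp
    then show "x \<in> {l + (?D k + ?D z) | k l. k \<in> ?K n \<and> l \<in> ?K (n - 1)}"
      using l(2) add_subgroup_0[OF add_subgroup_keys, of "tuples {t} n"] by blast
  qed
  also have "\<dots> = rel_class S t (n - 1) (?D z)"
    by (simp add: rel_class_def chains_eq r_coset_add_group)
  finally show ?thesis .
qed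

lemma chain_map_point:
  assumes "Poly_Mapping.keys z \<subseteq> tuples {t} n" shows "chain_map (\<lambda>_. t) z = z"
  by (rule chain_map_id_on) (use assms in \<open>auto simp: tuples_def\<close>)

lemma point_red_chains:
  assumes "z \<in> red_chains S n" "Poly_Mapping.keys z \<subseteq> tuples {t} n" shows "z = 0"
  using chain_map_point[OF assms(2)] chain_map_const_reduced[OF assms(1), of t] by simp

text \<open>Collapsing all entries to \<open>t\<close> is a projection to \<open>C({t})\<close> whose kernel is the reduced complex.\<close>

lemma reduced_part:
  assumes "Poly_Mapping.keys z \<subseteq> tuples S n" "t \<in> S"
  shows "z - chain_map (\<lambda>_. t) z \<in> red_chains S n"
    and "Poly_Mapping.keys (chain_map (\<lambda>_. t) z) \<subseteq> tuples {t} n"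
proof -
  show *: "Poly_Mapping.keys (chain_map (\<lambda>_. t) z) \<subseteq> tuples {t} n"
    by (rule keys_chain_map[OF assms(1)]) auto
  have "tuples {t} n \<subseteq> tuples S n"
    using assms(2) by (auto simp: tuples_def)
  then show "z - chain_map (\<lambda>_. t) z \<in> red_chains S n"
    using assms(1) * keys_diff[of z "chain_map (\<lambda>_. t) z"]
    by (auto simp: red_chains_def chain_map_diff chain_map_comp)
qed

text \<open>
  The map that sends a reduced cycle to its relative class is onto, because subtracting the part in
  \<open>C({t})\<close> from a relative cycle leaves a reduced chain whose boundary is both reduced and in
  \<open>C({t})\<close>, hence \<open>0\<close>. The same argument, applied to a relative chain that the cycle bounds,
  shows that its kernel consists of the reduced boundaries.
\<close>

theorem
  fixes S :: "'a::distrib_lattice set"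
  assumes S: "sublattice S" and t: "t \<in> S"
  shows group_rel_homology: "group (rel_homology a b c d S t n)"
    and red_homology_iso_rel_homology: "red_homology a b c d S n \<cong> rel_homology a b c d S t n"
proof -
  let ?D = "four_boundary a b c d :: int \<Rightarrow> ('a list \<Rightarrow>\<^sub>0 int) \<Rightarrow> _"
  let ?C = "\<lambda>n. {z. Poly_Mapping.keys z \<subseteq> tuples S n}"
  let ?r = "rel_class S t"
  let ?\<delta> = "rel_boundary a b c d S t"
  let ?G = "rel_chains S t"
  define Z where "Z = kernel (?G n) (?G (n - 1)) (?\<delta> n)"
  define B where "B = ?\<delta> (n + 1) ` carrier (?G (n + 1))"
  have D: "?D m z \<in> ?C (m - 1)" if "z \<in> ?C m" for m z
    using that keys_four_boundary[OF _ S] by auto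
  have DD: "?D m (?D (m + 1) z) = 0" if "z \<in> ?C (m + 1)" for m z
    using that by (intro four_boundary_four_boundary) (auto simp: tuples_def)
  have D_add: "?D m (z + w) = ?D m z + ?D m w" for m z w
    using four_boundary_diff[of a b c d m "z + w" w] by (simp add: eq_diff_eq)
  have r_add: "?r m z \<otimes>\<^bsub>?G m\<^esub> ?r m w = ?r m (z + w)" if "z \<in> ?C m" "w \<in> ?C m" for m z w
    using hom_mult[OF rel_class_hom[OF t, of m], of z w] that by (simp add: chains_eq)
  interpret G: comm_group "?G m" for m
    using t by (rule comm_group_rel_chains)
  have \<delta>: "group_hom (?G m) (?G (m - 1)) (?\<delta> m)" for m
  proof (intro group_hom.intro group_hom_axioms.intro G.is_group homI)
    fix X assume "X \<in> carrier (?G m)"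
    then show "?\<delta> m X \<in> carrier (?G (m - 1))"
      using D by (auto simp: carrier_rel_chains rel_boundary_class)
  next
    fix X Y assume "X \<in> carrier (?G m)" "Y \<in> carrier (?G m)"
    then obtain z w where "z \<in> ?C m" "w \<in> ?C m" "X = ?r m z" "Y = ?r m w"
      by (auto simp: carrier_rel_chains)
    then show "?\<delta> m (X \<otimes>\<^bsub>?G m\<^esub> Y) = ?\<delta> m X \<otimes>\<^bsub>?G (m - 1)\<^esub> ?\<delta> m Y"
      using D by (simp only: r_add rel_boundary_class D_add)
  qed
  have subZ: "subgroup Z (?G n)"
    unfolding Z_def by (rule group_hom.subgroup_kernel[OF \<delta>])
  have subB: "subgroup B (?G n)"
    using group_hom.img_is_subgroup[OF \<delta>[of "n + 1"]] by (simp add: B_def)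
  have ZI: "?r n z \<in> Z \<longleftrightarrow> Poly_Mapping.keys (?D n z) \<subseteq> tuples {t} (n - 1)" if "z \<in> ?C n" for z
    using that by (auto simp: Z_def kernel_def carrier_rel_chains rel_boundary_class one_rel_chains
        rel_class_eq_iff)
  have B_iff: "X \<in> B \<longleftrightarrow> (\<exists>w \<in> ?C (n + 1). X = ?r n (?D (n + 1) w))" for X
    by (simp add: B_def carrier_rel_chains image_image rel_boundary_class image_iff)
  have "B \<subseteq> Z"
    using D[of _ "n + 1"] DD by (auto simp: B_iff ZI)
  let ?GZ = "?G n\<lparr>carrier := Z\<rparr>"
  interpret GZ: comm_group ?GZ
  proof (rule group.group_comm_groupI[OF G.subgroup_imp_group[OF subZ]])
    fix X Y assume "X \<in> carrier ?GZ" "Y \<in> carrier ?GZ"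
    then have "X \<in> carrier (?G n)" "Y \<in> carrier (?G n)"
      using subgroup.subset[OF subZ] by auto
    then show "X \<otimes>\<^bsub>?GZ\<^esub> Y = Y \<otimes>\<^bsub>?GZ\<^esub> X"
      using G.m_comm by simp
  qed
  have BZ: "subgroup B ?GZ"
    by (rule G.subgroup_incl[OF subB subZ \<open>B \<subseteq> Z\<close>])
  then have nB: "B \<lhd> ?GZ"
    by (simp add: GZ.normal_iff_subgroup)
  have homology: "rel_homology a b c d S t n = ?GZ Mod B"
    by (simp add: rel_homology_def chain_homology_def Z_def B_def)
  have ker_eq: "B #>\<^bsub>?GZ\<^esub> X = B \<longleftrightarrow> X \<in> B" if "X \<in> Z" for X
    using GZ.coset_join1[OF _ _ BZ] GZ.coset_join2[OF _ BZ] that by auto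
  have cyc: "z \<in> ?C n" "?r n z \<in> Z" if "z \<in> red_cycles a b c d S n" for z
  proof -
    show C: "z \<in> ?C n"
      using that by (simp add: red_cycles_def red_chains_def)
    show "?r n z \<in> Z"
      using that four_boundary_reduced[of z S n a b c d] by (simp add: ZI[OF C] red_cycles_def)
  qed
  show grp: "group (rel_homology a b c d S t n)"
    unfolding homology using nB by (rule normal.factorgroup_is_group)
  show "red_homology a b c d S n \<cong> rel_homology a b c d S t n"
    unfolding red_homology_def homology
  proof (rule first_isomorphism_add_group[where h = "\<lambda>z. B #>\<^bsub>?GZ\<^esub> ?r n z"])
    show "add_subgroup (red_cycles a b c d S n)"
      by (rule add_subgroup_red_cycles)
    show "group (?GZ Mod B)"
      using grp by (simp add: homology)
    have "?r n \<in> hom (add_group (red_cycles a b c d S n)) ?GZ"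
      using cyc r_add by (intro homI) auto
    from hom_compose[OF this normal.r_coset_hom_Mod[OF nB]]
    show "(\<lambda>z. B #>\<^bsub>?GZ\<^esub> ?r n z) \<in> hom (add_group (red_cycles a b c d S n)) (?GZ Mod B)"
      by (simp add: comp_def)
    show "red_boundaries a b c d S n \<subseteq> red_cycles a b c d S n"
      by (rule red_boundaries_subset[OF S])
  next
    fix Y assume "Y \<in> carrier (?GZ Mod B)"
    then obtain X where X: "X \<in> Z" "Y = B #>\<^bsub>?GZ\<^esub> X"
      by (auto simp: carrier_FactGroup)
    then obtain z where z: "z \<in> ?C n" "X = ?r n z"
      using subgroup.subset[OF subZ] by (auto simp: carrier_rel_chains)
    define z' where "z' = z - chain_map (\<lambda>_. t) z"
    have z': "z' \<in> red_chains S n"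
      unfolding z'_def using z(1) t by (intro reduced_part(1)) auto
    have const: "Poly_Mapping.keys (chain_map (\<lambda>_. t) z) \<subseteq> tuples {t} n"
      using z(1) t by (intro reduced_part(2)) auto
    have "Poly_Mapping.keys (z' - z) \<subseteq> tuples {t} n"
      using const by (simp add: z'_def)
    then have r: "?r n z' = X"
      by (simp add: z(2) rel_class_eq_iff)
    have "z' \<in> ?C n"
      using z' by (simp add: red_chains_def)
    then have "Poly_Mapping.keys (?D n z') \<subseteq> tuples {t} (n - 1)"
      using X(1) r ZI[of z'] by simp
    then have "full_boundary a b c d z' = 0"
      using point_red_chains[OF full_boundary_red_chains[OF z' S, of a b c d], of t]
        four_boundary_reduced[OF z', of a b c d] by simp
    then have "z' \<in> red_cycles a b c d S n"
      using z' by (simp add: red_cycles_def)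
    then show "\<exists>z\<in>red_cycles a b c d S n. B #>\<^bsub>?GZ\<^esub> ?r n z = Y"
      using r X(2) by blast
  next
    fix z assume z: "z \<in> red_cycles a b c d S n"
    have "?r n z \<in> B \<longleftrightarrow> z \<in> red_boundaries a b c d S n"
    proof
      assume "?r n z \<in> B"
      then obtain w where w: "w \<in> ?C (n + 1)"
        and zw: "Poly_Mapping.keys (z - ?D (n + 1) w) \<subseteq> tuples {t} n"
        by (auto simp: B_iff rel_class_eq_iff)
      \<comment> \<open>Replacing \<open>w\<close> by its reduced part changes the boundary by an element of \<open>C({t})\<close> only.\<close>
      define u where "u = chain_map (\<lambda>_. t) w"
      have w': "w - u \<in> red_chains S (n + 1)"
        unfolding u_def using w t by (intro reduced_part(1)) auto
      have "Poly_Mapping.keys u \<subseteq> tuples {t} (n + 1)"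
        unfolding u_def using w t by (intro reduced_part(2)) auto
      then have "Poly_Mapping.keys (?D (n + 1) u) \<subseteq> tuples {t} n"
        using keys_four_boundary[of u "{t}" "n + 1" a b c d] by (simp add: sublattice_def)
      then have "Poly_Mapping.keys (z - ?D (n + 1) w + ?D (n + 1) u) \<subseteq> tuples {t} n"
        by (intro order_trans[OF keys_add] Un_least zw)
      then have "Poly_Mapping.keys (z - full_boundary a b c d (w - u)) \<subseteq> tuples {t} n"
        by (simp add: four_boundary_diff algebra_simps flip: four_boundary_reduced[OF w'])
      moreover have "z - full_boundary a b c d (w - u) \<in> red_chains S n"
        using z full_boundary_red_chains[OF w' S, of a b c d]
        by (simp add: red_cycles_def red_chains_diff)
      ultimately have "z = full_boundary a b c d (w - u)"
        using point_red_chains by force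
      then show "z \<in> red_boundaries a b c d S n"
        using w' by (simp add: red_boundaries_def)
    next
      assume "z \<in> red_boundaries a b c d S n"
      then obtain w where "w \<in> red_chains S (n + 1)" "z = ?D (n + 1) w"
        using four_boundary_reduced[of _ S "n + 1" a b c d] by (auto simp: red_boundaries_def)
      then show "?r n z \<in> B"
        by (auto simp: B_iff red_chains_def)
    qed
    then show "B #>\<^bsub>?GZ\<^esub> ?r n z = \<one>\<^bsub>?GZ Mod B\<^esub> \<longleftrightarrow> z \<in> red_boundaries a b c d S n"
      using ker_eq cyc(2)[OF z] by simp
  qed
qed

section \<open>Splitting the homology along an element\<close>

definition red_class ::
    "int \<Rightarrow> int \<Rightarrow> int \<Rightarrow> int \<Rightarrow> 'a::lattice set \<Rightarrow> int \<Rightarrow> ('a list \<Rightarrow>\<^sub>0 int) \<Rightarrow> ('a list \<Rightarrow>\<^sub>0 int) set"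
  where "red_class a b c d S n z =
    red_boundaries a b c d S n #>\<^bsub>add_group (red_cycles a b c d S n)\<^esub> z"

lemma red_class_hom:
  fixes S :: "'a::distrib_lattice set"
  assumes "sublattice S"
  shows "red_class a b c d S n \<in> hom (add_group (red_cycles a b c d S n)) (red_homology a b c d S n)"
  unfolding red_class_def[abs_def] red_homology_def
  by (intro normal.r_coset_hom_Mod normal_add_group add_subgroup_red_cycles
      add_subgroup_red_boundaries red_boundaries_subset assms)

lemma carrier_red_homology:
  "carrier (red_homology a b c d S n) = red_class a b c d S n ` red_cycles a b c d S n"
  by (simp add: red_homology_def carrier_FactGroup red_class_def)

lemma red_class_eq_one_iff:
  "red_class a b c d S n z = \<one>\<^bsub>red_homology a b c d S n\<^esub> \<longleftrightarrow> z \<in> red_boundaries a b c d S n"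
  by (simp add: red_class_def red_homology_def r_coset_add_group_eq_self_iff
      add_subgroup_red_boundaries)

lemma red_chains_cmul: "z \<in> red_chains S n \<Longrightarrow> frag_cmul k z \<in> red_chains S n"
  using keys_cmul[of k z] by (auto simp: red_chains_def chain_map_cmul)

lemma red_boundaries_cmul:
  assumes "z \<in> red_boundaries a b c d S n" shows "frag_cmul k z \<in> red_boundaries a b c d S n"
proof -
  obtain w where "w \<in> red_chains S (n + 1)" "z = full_boundary a b c d w"
    using assms by (auto simp: red_boundaries_def)
  then show ?thesis
    unfolding red_boundaries_def
    by (intro image_eqI[of _ _ "frag_cmul k w"]) (simp_all add: full_boundary_cmul red_chains_cmul)
qed

lemmas red_boundaries_add = add_subgroup_add[OF add_subgroup_red_boundaries]
  and red_boundaries_diff = add_subgroup_diff[OF add_subgroup_red_boundaries]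

lemma red_boundaries_chain_map:
  fixes g :: "'a::lattice \<Rightarrow> 'b::lattice"
  assumes "z \<in> red_boundaries a b c d S n" "g ` S \<subseteq> T"
    and "\<And>u v. g (sup u v) = sup (g u) (g v)" "\<And>u v. g (inf u v) = inf (g u) (g v)"
  shows "chain_map g z \<in> red_boundaries a b c d T n"
proof -
  obtain w where "w \<in> red_chains S (n + 1)" "z = full_boundary a b c d w"
    using assms(1) by (auto simp: red_boundaries_def)
  then show ?thesis
    unfolding red_boundaries_def using assms(2-)
    by (intro image_eqI[of _ _ "chain_map g w"])
      (simp_all add: chain_map_full_boundary red_chains_chain_map)
qed

lemma red_cycles_chain_map:
  fixes g :: "'a::lattice \<Rightarrow> 'b::lattice"
  assumes "z \<in> red_cycles a b c d S n" "g ` S \<subseteq> T"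
    and "\<And>u v. g (sup u v) = sup (g u) (g v)" "\<And>u v. g (inf u v) = inf (g u) (g v)"
  shows "chain_map g z \<in> red_cycles a b c d T n"
  using assms chain_map_full_boundary[of g a b c d z, symmetric]
  by (auto simp: red_cycles_def intro: red_chains_chain_map)

lemma red_boundaries_mono: "S \<subseteq> T \<Longrightarrow> red_boundaries a b c d S n \<subseteq> red_boundaries a b c d T n"
  unfolding red_boundaries_def by (intro image_mono red_chains_mono)

lemma red_cycles_mono: "S \<subseteq> T \<Longrightarrow> red_cycles a b c d S n \<subseteq> red_cycles a b c d T n"
  using red_chains_mono[of S T n] by (auto simp: red_cycles_def)

lemma sup_hom:
  fixes y :: "'a::distrib_lattice"
  shows "sup (sup u v) y = sup (sup u y) (sup v y)" "sup (inf u v) y = inf (sup u y) (sup v y)"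
  by (simp add: ac_simps) (simp add: sup_inf_distrib2)

lemma inf_hom:
  fixes y :: "'a::distrib_lattice"
  shows "inf (sup u v) y = sup (inf u y) (inf v y)" "inf (inf u v) y = inf (inf u y) (inf v y)"
  by (simp add: inf_sup_distrib2) (simp add: ac_simps)

text \<open>The cone over a reduced cycle is reduced, and the constant term of the homotopy vanishes.\<close>

lemma cone_relation:
  assumes "z \<in> red_cycles a b c d S n" "y \<in> S"
  shows "frag_cmul a z + frag_cmul b (chain_map (\<lambda>u. sup u y) z) +
    frag_cmul c (chain_map (\<lambda>u. inf u y) z) \<in> red_boundaries a b c d S n"
proof -
  have z: "z \<in> red_chains S n" "full_boundary a b c d z = 0"
    using assms(1) by (auto simp: red_cycles_def)
  show ?thesis
    using full_boundary_cone[of a b c d y z] red_chains_cone[OF z(1) assms(2)]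
    by (auto simp: red_boundaries_def z(2) chain_map_const_reduced[OF z(1), of y] intro: rev_image_eqI)
qed

lemma sublattice_lower_bound:
  assumes "sublattice S" "finite F" "F \<noteq> {}" "F \<subseteq> S"
  shows "\<exists>m\<in>S. \<forall>x\<in>F. m \<le> x"
  using assms(2-)
proof (induction F rule: finite_ne_induct)
  case (insert x F)
  then obtain m where "m \<in> S" "\<forall>x\<in>F. m \<le> x"
    by auto
  then show ?case
    using insert.prems assms(1)
    by (intro bexI[of _ "inf x m"]) (auto simp: sublattice_def intro: le_infI2)
qed auto

lemma sublattice_upper_bound:
  assumes "sublattice S" "finite F" "F \<noteq> {}" "F \<subseteq> S"
  shows "\<exists>m\<in>S. \<forall>x\<in>F. x \<le> m"
  using assms(2-)
proof (induction F rule: finite_ne_induct)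
  case (insert x F)
  then obtain m where "m \<in> S" "\<forall>x\<in>F. x \<le> m"
    by auto
  then show ?case
    using insert.prems assms(1)
    by (intro bexI[of _ "sup x m"]) (auto simp: sublattice_def intro: le_supI2)
qed auto

text \<open>
  The relation \<open>a + b P + c Q = 0\<close> holds for every element of \<open>S\<close>. If it lies below all entries of
  the given cycle \<open>z\<close>, then \<open>P z = z\<close> and \<open>Q z = 0\<close>; if it lies above them, the roles of \<open>P\<close>
  and \<open>Q\<close> are exchanged. As \<open>S\<close> need not have bounds, the element has to depend on \<open>z\<close>.
\<close>

lemma annihilators_of_reduced_homology:
  fixes S :: "'a::distrib_lattice set"
  assumes S: "sublattice S" "S \<noteq> {}" and z: "z \<in> red_cycles a b c d S n"
  shows "frag_cmul (a + b) z \<in> red_boundaries a b c d S n"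
    and "frag_cmul (a + c) z \<in> red_boundaries a b c d S n"
proof -
  obtain s where "s \<in> S" using S(2) by blast
  define F where "F = insert s (\<Union>xs\<in>Poly_Mapping.keys z. set xs)"
  have chain: "z \<in> red_chains S n"
    using z by (simp add: red_cycles_def)
  have F: "finite F" "F \<noteq> {}" "F \<subseteq> S"
    using \<open>s \<in> S\<close> chain by (auto simp: F_def red_chains_def tuples_def)
  have in_F: "u \<in> F" if "xs \<in> Poly_Mapping.keys z" "u \<in> set xs" for xs u
    using that by (auto simp: F_def)
  obtain m where m: "m \<in> S" "\<forall>x\<in>F. m \<le> x"
    using sublattice_lower_bound[OF S(1) F] by blast
  have "chain_map (\<lambda>u. sup u m) z = z"
    by (rule chain_map_id_on) (use in_F m(2) in \<open>auto simp: sup_absorb1\<close>)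
  moreover have "chain_map (\<lambda>u. inf u m) z = chain_map (\<lambda>_. m) z"
    by (rule chain_map_cong) (use in_F m(2) in \<open>auto simp: inf_absorb2\<close>)
  ultimately show "frag_cmul (a + b) z \<in> red_boundaries a b c d S n"
    using cone_relation[OF z m(1)] chain_map_const_reduced[OF chain, of m]
    by (simp add: frag_cmul_distrib)
  obtain m where m: "m \<in> S" "\<forall>x\<in>F. x \<le> m"
    using sublattice_upper_bound[OF S(1) F] by blast
  have "chain_map (\<lambda>u. inf u m) z = z"
    by (rule chain_map_id_on) (use in_F m(2) in \<open>auto simp: inf_absorb1\<close>)
  moreover have "chain_map (\<lambda>u. sup u m) z = chain_map (\<lambda>_. m) z"
    by (rule chain_map_cong) (use in_F m(2) in \<open>auto simp: sup_absorb2\<close>)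
  ultimately show "frag_cmul (a + c) z \<in> red_boundaries a b c d S n"
    using cone_relation[OF z m(1)] chain_map_const_reduced[OF chain, of m]
    by (simp add: frag_cmul_distrib)
qed

lemma bezout_three:
  assumes "Gcd {a, b, c :: int} = 1"
  obtains u v w where "u * a + v * b + w * c = 1"
proof -
  obtain p q where pq: "p * b + q * c = gcd b c"
    using bezout_int by blast
  obtain u r where "u * a + r * gcd b c = gcd a (gcd b c)"
    using bezout_int by blast
  then have "u * a + (r * p) * b + (r * q) * c = 1"
    using assms by (simp add: algebra_simps flip: pq)
  then show ?thesis
    using that by blast
qed

text \<open>
  Both \<open>P\<close> and \<open>Q\<close> kill \<open>R = z - P z - Q z\<close>, since they are idempotent and their composites are
  induced by constants. Thus \<open>a R\<close>, \<open>(a + b) R\<close> and \<open>(a + c) R\<close> are boundaries, and so is \<open>R\<close>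
  because \<open>a\<close>, \<open>b\<close>, \<open>c\<close> are jointly coprime.
\<close>

lemma complement_of_retracts_is_boundary:
  fixes S :: "'a::distrib_lattice set"
  assumes gcd: "Gcd {a, b, c} = 1" and S: "sublattice S" and y: "y \<in> S"
    and z: "z \<in> red_cycles a b c d S n"
  shows "z - chain_map (\<lambda>u. sup u y) z - chain_map (\<lambda>u. inf u y) z \<in> red_boundaries a b c d S n"
proof -
  let ?P = "chain_map (\<lambda>u. sup u y)" and ?Q = "chain_map (\<lambda>u. inf u y)"
  let ?B = "red_boundaries a b c d S n"
  define R where "R = z - ?P z - ?Q z"
  have "?P z \<in> red_cycles a b c d S n"
    using y S by (intro red_cycles_chain_map[OF z] sup_hom) (auto simp: sublattice_def)
  moreover have "?Q z \<in> red_cycles a b c d S n"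
    using y S by (intro red_cycles_chain_map[OF z] inf_hom) (auto simp: sublattice_def)
  ultimately have R: "R \<in> red_cycles a b c d S n"
    unfolding R_def by (intro add_subgroup_diff[OF add_subgroup_red_cycles] z)
  have const: "chain_map (\<lambda>_. y) z = 0"
    using z by (intro chain_map_const_reduced) (auto simp: red_cycles_def)
  have "sup (inf u y) y = y" "inf (sup u y) y = y" for u
    by (simp_all add: sup_absorb2 inf_absorb2)
  then have "?P R = 0" "?Q R = 0"
    by (simp_all add: R_def chain_map_diff chain_map_comp const sup_assoc inf_assoc)
  then have aR: "frag_cmul a R \<in> ?B"
    using cone_relation[OF R y] by simp
  have "frag_cmul (a + b) R - frag_cmul a R \<in> ?B"
    using annihilators_of_reduced_homology(1)[OF S _ R] y by (intro red_boundaries_diff aR) blast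
  then have bR: "frag_cmul b R \<in> ?B"
    by (simp flip: frag_cmul_diff_distrib)
  have "frag_cmul (a + c) R - frag_cmul a R \<in> ?B"
    using annihilators_of_reduced_homology(2)[OF S _ R] y by (intro red_boundaries_diff aR) blast
  then have cR: "frag_cmul c R \<in> ?B"
    by (simp flip: frag_cmul_diff_distrib)
  obtain u v w where uvw: "u * a + v * b + w * c = 1"
    using bezout_three[OF gcd] .
  have "frag_cmul u (frag_cmul a R) + frag_cmul v (frag_cmul b R) + frag_cmul w (frag_cmul c R) \<in> ?B"
    by (intro red_boundaries_add red_boundaries_cmul aR bR cR)
  moreover have "frag_cmul u (frag_cmul a R) + frag_cmul v (frag_cmul b R) +
      frag_cmul w (frag_cmul c R) = frag_cmul (u * a + v * b + w * c) R"
    by (simp add: frag_cmul_distrib)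
  ultimately show ?thesis
    by (simp add: uvw R_def)
qed

text \<open>
  The isomorphism is induced by \<open>z \<mapsto> (P z, Q z)\<close>. It is onto because \<open>P\<close> and \<open>Q\<close> are retractions
  and each of them collapses the other part to the constant \<open>y\<close>. It is injective because
  \<open>z - P z - Q z\<close> bounds.
\<close>

theorem red_homology_split:
  fixes S :: "'a::distrib_lattice set"
  assumes gcd: "Gcd {a, b, c} = 1" and S: "sublattice S" and y: "y \<in> S"
  shows "red_homology a b c d S n \<cong>
    red_homology a b c d (S \<inter> {y..}) n \<times>\<times> red_homology a b c d (S \<inter> {..y}) n"
proof -
  let ?P = "chain_map (\<lambda>u. sup u y)" and ?Q = "chain_map (\<lambda>u. inf u y)"
  let ?U = "S \<inter> {y..}" and ?L = "S \<inter> {..y}"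
  let ?Z = "\<lambda>S. red_cycles a b c d S n" and ?B = "\<lambda>S. red_boundaries a b c d S n"
  let ?H = "\<lambda>S. red_homology a b c d S n" and ?cl = "\<lambda>S. red_class a b c d S n"
  have U: "sublattice ?U" and L: "sublattice ?L"
    using S by (auto simp: sublattice_def intro: le_supI1 le_infI1)
  have PU: "(\<lambda>u. sup u y) ` S \<subseteq> ?U" and QL: "(\<lambda>u. inf u y) ` S \<subseteq> ?L"
    using S y by (auto simp: sublattice_def)
  have P: "?P z \<in> ?Z ?U" if "z \<in> ?Z S" for z
    using that PU by (rule red_cycles_chain_map) (rule sup_hom)+
  have Q: "?Q z \<in> ?Z ?L" if "z \<in> ?Z S" for z
    using that QL by (rule red_cycles_chain_map) (rule inf_hom)+
  show ?thesis
    unfolding red_homology_def[of a b c d S n]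
  proof (rule first_isomorphism_add_group[where h = "\<lambda>z. (?cl ?U (?P z), ?cl ?L (?Q z))"])
    show "add_subgroup (?Z S)" "group (?H ?U \<times>\<times> ?H ?L)" "?B S \<subseteq> ?Z S"
      by (intro add_subgroup_red_cycles DirProd_group group_red_homology U L
          red_boundaries_subset S)+
    show "(\<lambda>z. (?cl ?U (?P z), ?cl ?L (?Q z))) \<in> hom (add_group (?Z S)) (?H ?U \<times>\<times> ?H ?L)"
      using P Q hom_mult[OF red_class_hom[OF U]] hom_mult[OF red_class_hom[OF L]]
      by (intro homI) (auto simp: carrier_red_homology chain_map_add)
  next
    fix X assume "X \<in> carrier (?H ?U \<times>\<times> ?H ?L)"
    then obtain v w where v: "v \<in> ?Z ?U" and w: "w \<in> ?Z ?L" and X: "X = (?cl ?U v, ?cl ?L w)"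
      by (auto simp: carrier_red_homology)
    have v': "v \<in> red_chains ?U n" and w': "w \<in> red_chains ?L n"
      using v w by (auto simp: red_cycles_def)
    have "?P v = v" "?Q w = w"
      by (rule chain_map_id_on;
          use v' w' in \<open>auto simp: red_chains_def tuples_def sup_absorb1 inf_absorb1\<close>)+
    moreover have "?P w = chain_map (\<lambda>_. y) w" "?Q v = chain_map (\<lambda>_. y) v"
      by (rule chain_map_cong;
          use v' w' in \<open>auto simp: red_chains_def tuples_def sup_absorb2 inf_absorb2\<close>)+
    ultimately have "?P (v + w) = v" "?Q (v + w) = w"
      using chain_map_const_reduced[OF v', of y] chain_map_const_reduced[OF w', of y]
      by (simp_all add: chain_map_add)
    moreover have "v + w \<in> ?Z S"
      using v w red_cycles_mono[of ?U S a b c d n] red_cycles_mono[of ?L S a b c d n]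
      by (intro add_subgroup_add[OF add_subgroup_red_cycles]) auto
    ultimately show "\<exists>z\<in>?Z S. (?cl ?U (?P z), ?cl ?L (?Q z)) = X"
      using X by (intro bexI[of _ "v + w"]) auto
  next
    fix z assume z: "z \<in> ?Z S"
    have "?P z \<in> ?B ?U \<and> ?Q z \<in> ?B ?L \<longleftrightarrow> z \<in> ?B S"
    proof
      assume "?P z \<in> ?B ?U \<and> ?Q z \<in> ?B ?L"
      then have "?P z \<in> ?B S" "?Q z \<in> ?B S"
        using red_boundaries_mono[of ?U S a b c d n] red_boundaries_mono[of ?L S a b c d n] by auto
      then have "z - ?P z - ?Q z + ?P z + ?Q z \<in> ?B S"
        using complement_of_retracts_is_boundary[OF gcd S y z] by (intro red_boundaries_add)
      then show "z \<in> ?B S" by simp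
    next
      assume z: "z \<in> ?B S"
      show "?P z \<in> ?B ?U \<and> ?Q z \<in> ?B ?L"
        using red_boundaries_chain_map[OF z PU sup_hom] red_boundaries_chain_map[OF z QL inf_hom]
        by blast
    qed
    then show "(?cl ?U (?P z), ?cl ?L (?Q z)) = \<one>\<^bsub>?H ?U \<times>\<times> ?H ?L\<^esub> \<longleftrightarrow> z \<in> ?B S"
      by (simp add: red_class_eq_one_iff)
  qed
qed

section \<open>Finite distributive lattices\<close>

text \<open>
  The inverse of the inclusion of \<open>bool\<close> as \<open>{y, x}\<close> is a homomorphism on \<open>{y, x}\<close> only; its
  compatibility with the differential is transported from that of the inclusion.
\<close>

lemma red_homology_two_chain:
  fixes x y :: "'a::distrib_lattice"
  assumes "y < x"
  shows "red_homology a b c d (UNIV :: bool set) n \<cong> red_homology a b c d {y, x} n"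
proof -
  let ?g = "\<lambda>u. if u then x else y" and ?k = "\<lambda>u. u = x"
  let ?Z = "red_cycles a b c d {y, x} n" and ?B = "red_boundaries a b c d {y, x} n"
  have S: "sublattice {y, x}" "sublattice (UNIV :: bool set)"
    using assms by (auto simp: sublattice_def sup_absorb1 sup_absorb2 inf_absorb1 inf_absorb2)
  have hom: "?g (sup u v) = sup (?g u) (?g v)" "?g (inf u v) = inf (?g u) (?g v)" for u v
    using assms by (auto simp: sup_absorb1 sup_absorb2 inf_absorb1 inf_absorb2)
  have kg: "chain_map ?k (chain_map ?g z) = z" for z
    unfolding chain_map_comp by (rule chain_map_id_on) (use assms in auto)
  have gk: "chain_map ?g (chain_map ?k v) = v" if "v \<in> red_chains {y, x} m" for v m
    unfolding chain_map_comp
    by (rule chain_map_id_on) (use that in \<open>auto simp: red_chains_def tuples_def\<close>)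
  have k: "chain_map ?k v \<in> red_chains UNIV m" if "v \<in> red_chains {y, x} m" for v m
    using that by (rule red_chains_chain_map) simp
  have g: "chain_map ?g z \<in> ?Z" if "z \<in> red_cycles a b c d UNIV n" for z
    by (rule red_cycles_chain_map[OF that _ hom]) auto
  have boundary: "full_boundary a b c d (chain_map ?k v) = chain_map ?k (full_boundary a b c d v)"
    if "v \<in> red_chains {y, x} m" for v m
    using chain_map_full_boundary[of ?g a b c d "chain_map ?k v", OF hom] gk[OF that] kg by metis
  show ?thesis
    unfolding red_homology_def[of a b c d UNIV n]
  proof (rule first_isomorphism_add_group[where h = "\<lambda>z. red_class a b c d {y, x} n (chain_map ?g z)"])
    show "add_subgroup (red_cycles a b c d (UNIV :: bool set) n)"
      "group (red_homology a b c d {y, x} n)"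
      "red_boundaries a b c d (UNIV :: bool set) n \<subseteq> red_cycles a b c d UNIV n"
      by (intro add_subgroup_red_cycles group_red_homology red_boundaries_subset S)+
    show "(\<lambda>z. red_class a b c d {y, x} n (chain_map ?g z))
        \<in> hom (add_group (red_cycles a b c d UNIV n)) (red_homology a b c d {y, x} n)"
      using g hom_mult[OF red_class_hom[OF S(1)]]
      by (intro homI) (auto simp: carrier_red_homology chain_map_add)
  next
    fix X assume "X \<in> carrier (red_homology a b c d {y, x} n)"
    then obtain v where v: "v \<in> ?Z" "X = red_class a b c d {y, x} n v"
      by (auto simp: carrier_red_homology)
    then have "v \<in> red_chains {y, x} n" "full_boundary a b c d v = 0"
      by (auto simp: red_cycles_def)
    then have "chain_map ?k v \<in> red_cycles a b c d UNIV n" "chain_map ?g (chain_map ?k v) = v"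
      using k gk boundary by (auto simp: red_cycles_def)
    then show "\<exists>z\<in>red_cycles a b c d UNIV n. red_class a b c d {y, x} n (chain_map ?g z) = X"
      using v(2) by (intro bexI[of _ "chain_map ?k v"]) simp_all
  next
    fix z assume "z \<in> red_cycles a b c d (UNIV :: bool set) n"
    have "chain_map ?g z \<in> ?B \<longleftrightarrow> z \<in> red_boundaries a b c d UNIV n"
    proof
      assume "chain_map ?g z \<in> ?B"
      then obtain w where w: "w \<in> red_chains {y, x} (n + 1)"
          "chain_map ?g z = full_boundary a b c d w"
        by (auto simp: red_boundaries_def)
      then have "z = full_boundary a b c d (chain_map ?k w)"
        using boundary kg by metis
      then show "z \<in> red_boundaries a b c d UNIV n"
        using k[OF w(1)] by (simp add: red_boundaries_def)
    next
      assume z: "z \<in> red_boundaries a b c d UNIV n"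
      show "chain_map ?g z \<in> ?B"
        by (rule red_boundaries_chain_map[OF z _ hom]) auto
    qed
    then show "red_class a b c d {y, x} n (chain_map ?g z) = \<one>\<^bsub>red_homology a b c d {y, x} n\<^esub>
        \<longleftrightarrow> z \<in> red_boundaries a b c d UNIV n"
      by (simp add: red_class_eq_one_iff)
  qed
qed

lemma red_homology_point:
  fixes x :: "'a::distrib_lattice"
  assumes "group A"
  shows "red_homology a b c d {x} n \<cong> sum_group {..<0::nat} (\<lambda>_. A)"
proof -
  have chains: "red_chains {x} m = {0}" for m
    using point_red_chains[of _ "{x}" m x] red_chains_zero[of "{x}" m]
    by (auto simp: red_chains_def)
  have "sublattice {x}"
    by (simp add: sublattice_def)
  then show ?thesis
    unfolding red_homology_def
    using assms
    by (intro first_isomorphism_add_group[where h = "\<lambda>_. \<one>\<^bsub>sum_group {..<0::nat} (\<lambda>_. A)\<^esub>"]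
        add_subgroup_red_cycles sum_group red_boundaries_subset)
      (auto simp: red_cycles_def red_boundaries_def chains carrier_sum_group fun_eq_iff intro!: homI)
qed

lemma sum_group_Suc:
  assumes "group A"
  shows "A \<times>\<times> sum_group {..<k} (\<lambda>_. A) \<cong> sum_group {..<Suc k} (\<lambda>_. A)"
proof -
  let ?h = "\<lambda>(x, f). f(k := x)"
  have carrier: "carrier (sum_group {..<m} (\<lambda>_. A)) = {..<m} \<rightarrow>\<^sub>E carrier A" for m :: nat
    using assms by (auto simp: carrier_sum_group)
  have bij: "bij_betw ?h (carrier A \<times> ({..<k} \<rightarrow>\<^sub>E carrier A)) ({..<Suc k} \<rightarrow>\<^sub>E carrier A)"
    unfolding bij_betw_def lessThan_Suc
    using inj_combinator[of k "{..<k}" "\<lambda>_. carrier A"] by (simp add: PiE_insert_eq)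
  have "?h \<in> hom (A \<times>\<times> sum_group {..<k} (\<lambda>_. A)) (sum_group {..<Suc k} (\<lambda>_. A))"
  proof (rule homI)
    fix p assume "p \<in> carrier (A \<times>\<times> sum_group {..<k} (\<lambda>_. A))"
    then show "?h p \<in> carrier (sum_group {..<Suc k} (\<lambda>_. A))"
      using bij_betwE[OF bij] by (auto simp: carrier)
  next
    fix p q
    show "?h (p \<otimes>\<^bsub>A \<times>\<times> sum_group {..<k} (\<lambda>_. A)\<^esub> q) =
        ?h p \<otimes>\<^bsub>sum_group {..<Suc k} (\<lambda>_. A)\<^esub> ?h q"
      by (cases p; cases q) (auto simp: restrict_def)
  qed
  then show ?thesis
    unfolding is_iso_def iso_def using bij by (auto simp: carrier)
qed

text \<open>
  A minimal element among those below \<open>x\<close> and not below \<open>y\<close> is join-irreducible. If \<open>i\<close> and \<open>k\<close>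
  are both below \<open>x\<close>, not below \<open>y\<close>, and \<open>i\<close> is join-irreducible, then \<open>sup k y = x\<close>, whence
  \<open>i = sup (inf i k) (inf i y)\<close> and so \<open>i \<le> k\<close>. This makes the join-irreducible one unique.
\<close>

lemma unique_join_irreducible_outside_lower_cover:
  fixes x y :: "'a::distrib_lattice"
  assumes fin: "finite (UNIV :: 'a set)" and "y < x" and max: "\<And>u. y \<le> u \<Longrightarrow> u < x \<Longrightarrow> u = y"
  shows "\<exists>j. {j. j \<le> x \<and> join_irreducible j \<and> \<not> is_minimum j \<and> \<not> j \<le> y} = {j}"
proof -
  have "finite {u. u \<le> x \<and> \<not> u \<le> y}"
    by (rule finite_subset[OF subset_UNIV fin])
  moreover have "x \<in> {u. u \<le> x \<and> \<not> u \<le> y}"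
    using \<open>y < x\<close> by (simp add: less_le_not_le)
  ultimately obtain j where j: "j \<le> x" "\<not> j \<le> y"
    and minimal: "\<And>u. u \<le> x \<Longrightarrow> \<not> u \<le> y \<Longrightarrow> u \<le> j \<Longrightarrow> u = j"
    using finite_has_minimal[of "{u. u \<le> x \<and> \<not> u \<le> y}"]
    by (metis (no_types, lifting) empty_iff mem_Collect_eq)
  have irr: "join_irreducible j"
    unfolding join_irreducible_def
  proof (intro allI impI)
    fix u v assume uv: "j = sup u v"
    then have "u \<le> j" "v \<le> j" "u \<le> x" "v \<le> x"
      using j(1) by auto
    moreover have "\<not> u \<le> y \<or> \<not> v \<le> y"
      using uv j(2) by auto
    ultimately show "j = u \<or> j = v"
      using minimal[of u] minimal[of v] by auto
  qed
  have below: "i \<le> k" if "k \<le> x" "\<not> k \<le> y" "i \<le> x" "join_irreducible i" "\<not> i \<le> y" for i k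
  proof -
    have "sup k y = x"
      using that \<open>y < x\<close> max[of "sup k y"]
      by (metis le_sup_iff less_le sup.cobounded1 sup.cobounded2)
    then have "i = sup (inf i k) (inf i y)"
      using \<open>i \<le> x\<close> by (metis inf_absorb1 inf_sup_distrib1)
    then show ?thesis
      using that by (metis inf.cobounded2 join_irreducible_def)
  qed
  have "i = j" if "i \<le> x" "join_irreducible i" "\<not> i \<le> y" for i
    using below[of j i] below[of i j] that j irr by (simp add: order_antisym)
  moreover have "\<not> is_minimum j"
    using j(2) by (auto simp: is_minimum_def)
  ultimately have "{j. j \<le> x \<and> join_irreducible j \<and> \<not> is_minimum j \<and> \<not> j \<le> y} = {j}"
    using j irr by blast
  then show ?thesis ..
qed

text \<open>
  Principal ideals are closed downwards, so join-irreducibility in them is join-irreducibility in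
  the whole lattice, and the counts for the smaller ideals are comparable.
\<close>

lemma red_homology_principal_ideal:
  fixes x :: "'a::distrib_lattice"
  assumes gcd: "Gcd {a, b, c} = 1" and fin: "finite (UNIV :: 'a set)"
  shows "red_homology a b c d {..x} n \<cong>
    sum_group {..<card {j. j \<le> x \<and> join_irreducible j \<and> \<not> is_minimum j}}
      (\<lambda>_. red_homology a b c d (UNIV :: bool set) n)"
proof (induction "card {..x}" arbitrary: x rule: less_induct)
  case less
  let ?A = "red_homology a b c d (UNIV :: bool set) n"
  let ?J = "\<lambda>x. {j. j \<le> x \<and> join_irreducible j \<and> \<not> is_minimum j}"
  have A: "group ?A"
    by (intro group_red_homology) (simp add: sublattice_def)
  have fin': "finite T" for T :: "'a set"
    by (rule finite_subset[OF subset_UNIV fin])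
  show ?case
  proof (cases "is_minimum x")
    case True
    then have least: "{..x} = {x}"
      by (auto simp: is_minimum_def order_antisym)
    then have "?J x \<subseteq> {x}"
      by blast
    then have "?J x = {}"
      using True by blast
    then have "card (?J x) = 0"
      by (simp only: card.empty)
    then show ?thesis
      using red_homology_point[OF A, of a b c d x n] by (simp only: least)
  next
    case False
    then obtain v where "\<not> x \<le> v"
      by (auto simp: is_minimum_def)
    then have "inf x v \<in> {u. u < x}"
      by (simp add: less_le_not_le)
    then obtain y where y: "y < x" and max: "\<And>u. u < x \<Longrightarrow> y \<le> u \<Longrightarrow> u = y"
      using finite_has_maximal[of "{u. u < x}"] fin' by auto
    have "{..x} \<inter> {y..} = {y, x}"
      using y max by (auto simp: less_le)
    moreover have "{..x} \<inter> {..y} = {..y}"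
      using y by auto
    ultimately have split: "red_homology a b c d {..x} n \<cong>
        red_homology a b c d {y, x} n \<times>\<times> red_homology a b c d {..y} n"
      using red_homology_split[OF gcd, of "{..x}" y d n] y
      by (simp add: sublattice_def le_infI1)
    have "card {..y} < card {..x}"
      using y fin' by (intro psubset_card_mono) auto
    then have IH: "red_homology a b c d {..y} n \<cong> sum_group {..<card (?J y)} (\<lambda>_. ?A)"
      by (rule less)
    obtain j where "{j. j \<le> x \<and> join_irreducible j \<and> \<not> is_minimum j \<and> \<not> j \<le> y} = {j}"
      using unique_join_irreducible_outside_lower_cover[OF fin y] max by blast
    then have "?J x = insert j (?J y)" "j \<notin> ?J y"
      using y by (auto intro: order_trans)
    then have card: "card (?J x) = Suc (card (?J y))"
      using fin' by simp
    have Y: "sublattice {y, x}"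
      using y by (auto simp: sublattice_def sup_absorb1 sup_absorb2 inf_absorb1 inf_absorb2)
    have "red_homology a b c d {y, x} n \<cong> ?A"
      using group.iso_sym[OF A red_homology_two_chain[OF y]] .
    then have "red_homology a b c d {y, x} n \<times>\<times> red_homology a b c d {..y} n \<cong>
        ?A \<times>\<times> sum_group {..<card (?J y)} (\<lambda>_. ?A)"
      using IH by (rule group.DirProd_iso_trans[OF group_red_homology[OF Y]])
    then show ?thesis
      using iso_trans[OF iso_trans[OF split] sum_group_Suc[OF A]] by (simp add: card)
  qed
qed

theorem lemma5p10:
  fixes t :: "'a::distrib_lattice" and a b c d n :: int
  assumes "Gcd {a, b, c} = 1"
  shows "(\<forall>y. rel_homology a b c d UNIV t n \<cong>
            rel_homology a b c d {y..} (sup t y) n \<times>\<times> rel_homology a b c d {..y} (inf t y) n) \<and>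
         (finite (UNIV :: 'a set) \<longrightarrow>
            rel_homology a b c d UNIV t n \<cong>
            sum_group {..<card {x :: 'a. join_irreducible x \<and> \<not> is_minimum x}}
              (\<lambda>_. rel_homology a b c d (UNIV :: bool set) bot n))"
proof (intro conjI allI impI)
  have univ: "sublattice (UNIV :: 'a set)" "sublattice (UNIV :: bool set)"
    by (simp_all add: sublattice_def)
  have reduce: "rel_homology a b c d UNIV t n \<cong> red_homology a b c d (UNIV :: 'a set) n"
    by (rule group.iso_sym[OF group_red_homology[OF univ(1)]
          red_homology_iso_rel_homology[OF univ(1) UNIV_I]])
  show "rel_homology a b c d UNIV t n \<cong>
      rel_homology a b c d {y..} (sup t y) n \<times>\<times> rel_homology a b c d {..y} (inf t y) n" for y
  proof -
    have U: "sublattice {y..}" and L: "sublattice {..y}"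
      by (auto simp: sublattice_def intro: le_supI1 le_infI1)
    have "red_homology a b c d (UNIV :: 'a set) n \<cong>
        red_homology a b c d {y..} n \<times>\<times> red_homology a b c d {..y} n"
      using red_homology_split[OF assms univ(1), of y d n] by simp
    moreover have "red_homology a b c d {y..} n \<times>\<times> red_homology a b c d {..y} n \<cong>
        rel_homology a b c d {y..} (sup t y) n \<times>\<times> rel_homology a b c d {..y} (inf t y) n"
      by (intro group.DirProd_iso_trans group_red_homology red_homology_iso_rel_homology U L) auto
    ultimately show ?thesis
      by (rule iso_trans[OF reduce iso_trans])
  qed
  assume fin: "finite (UNIV :: 'a set)"
  obtain m :: 'a where "\<forall>x. x \<le> m"
    using sublattice_upper_bound[OF univ(1) fin] by auto
  then have "{..m} = UNIV" "{j. j \<le> m \<and> join_irreducible j \<and> \<not> is_minimum j} =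
      {j. join_irreducible j \<and> \<not> is_minimum j}"
    by auto
  then have "red_homology a b c d (UNIV :: 'a set) n \<cong>
      sum_group {..<card {x :: 'a. join_irreducible x \<and> \<not> is_minimum x}}
        (\<lambda>_. red_homology a b c d (UNIV :: bool set) n)"
    using red_homology_principal_ideal[OF assms fin, of d m n] by simp
  moreover have "sum_group {..<card {x :: 'a. join_irreducible x \<and> \<not> is_minimum x}}
        (\<lambda>_. red_homology a b c d (UNIV :: bool set) n) \<cong>
      sum_group {..<card {x :: 'a. join_irreducible x \<and> \<not> is_minimum x}}
        (\<lambda>_. rel_homology a b c d (UNIV :: bool set) bot n)"
    using univ(2) by (intro iso_sum_groupI group_red_homology group_rel_homology
        red_homology_iso_rel_homology) auto
  ultimately show "rel_homology a b c d UNIV t n \<cong>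
      sum_group {..<card {x :: 'a. join_irreducible x \<and> \<not> is_minimum x}}
        (\<lambda>_. rel_homology a b c d (UNIV :: bool set) bot n)"
    by (rule iso_trans[OF reduce iso_trans])
qed

end
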